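(* Let $N$ be a positive integer. Suppose $M$ and $K$ are positive integers with $M^2+N=2K^2$ and $M^2<N$, and suppose $K$ divides $N$ (or equivalently, $K$ divides $M^2$). Let $ABC$ be the triangle with sides $BC=MN/K$, $AC=N-K^2$, and $AB=K^2$, and let the triangle $T$ have sides $a=M$, $b=N/K-K$ (which must be a positive integer), and $c=K$. Then there is an $N$-tiling of triangle $ABC$ by the tile $T$. This tile satisfies $3\alpha+2\beta=\pi$, and $ABC$ has angles $(2\alpha,\beta,\alpha+\beta)$ (at $A$, $B$, $C$ respectively), where $\alpha,\beta,\gamma$ are the angles of $T$ opposite $a,b,c$.
   Context: An $N$-tiling of a triangle $ABC$ by a triangle $T$ (the tile) is a way of writing $ABC$ as a union of $N$ triangles congruent to $T$ (reflections allowed) overlapping only at their boundaries; tiles need not meet edge-to-edge. *)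

theory Defs
  imports "HOL-Analysis.Analysis"
begin

type_synonym point = "real ^ 2"

text \<open>Nondegenerate triangle with \<open>x\<close>, \<open>y\<close>, \<open>z\<close> the lengths of the sides opposite
  \<open>A\<close>, \<open>B\<close>, \<open>C\<close>.\<close>

definition triangle_with_sides ::
    "point \<Rightarrow> point \<Rightarrow> point \<Rightarrow> real \<Rightarrow> real \<Rightarrow> real \<Rightarrow> bool" where
  "triangle_with_sides A B C x y z \<longleftrightarrow>
     \<not> collinear {A, B, C} \<and> dist B C = x \<and> dist A C = y \<and> dist A B = z"

text \<open>Unoriented angle \<open>PQR\<close> with vertex \<open>Q\<close>; meaningful only for \<open>P \<noteq> Q \<noteq> R\<close>.\<close>

definition angle :: "point \<Rightarrow> point \<Rightarrow> point \<Rightarrow> real" where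
  "angle P Q R = arccos (((P - Q) \<bullet> (R - Q)) / (norm (P - Q) * norm (R - Q)))"

text \<open>Isometries need not preserve orientation, so reflected copies are congruent.\<close>

definition congruent_figs :: "point set \<Rightarrow> point set \<Rightarrow> bool" where
  "congruent_figs S T \<longleftrightarrow> (\<exists>f. (\<forall>x y. dist (f x) (f y) = dist x y) \<and> f ` T = S)"

definition is_tiling :: "nat \<Rightarrow> point set \<Rightarrow> point set \<Rightarrow> point set set \<Rightarrow> bool" where
  "is_tiling N S T \<T> \<longleftrightarrow>
     finite \<T> \<and> card \<T> = N \<and> \<Union>\<T> = S \<and>
     (\<forall>U\<in>\<T>. congruent_figs U T) \<and>
     (\<forall>U\<in>\<T>. \<forall>V\<in>\<T>. U \<noteq> V \<longrightarrow> U \<inter> V \<subseteq> frontier U \<inter> frontier V)"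

end

theory Submission
  imports Defs
begin

text \<open>Put \<open>b = N/K - K\<close>, so that \<open>a\<^sup>2 + b c = c\<^sup>2\<close> and \<open>N = c\<^sup>2 + b c\<close>. On the bisector at \<open>A\<close> take \<open>O\<close>
  with \<open>AO = b\<^sup>2\<close>, on \<open>AB\<close> take \<open>X\<close> with \<open>AX = b c\<close>, and on \<open>BC\<close> take \<open>Y\<close> with \<open>CY = a c\<close>. Then
  \<open>AXO\<close> and \<open>ACO\<close> are copies of the tile scaled by \<open>b\<close>, \<open>COY\<close> is a copy scaled by \<open>a\<close>, and
  \<open>XBYO\<close> is a parallelogram with sides \<open>(c - b) c\<close> and \<open>b a\<close> and angle \<open>\<beta>\<close>. At \<open>O\<close> three angles
  \<open>\<gamma>\<close> and one angle \<open>\<beta>\<close> meet. The pieces need \<open>b\<^sup>2 + b\<^sup>2 + a\<^sup>2 + 2 b (c - b) = N\<close> tiles.\<close>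

section \<open>Covers by tiles\<close>

text \<open>Only the side lengths enter, so mirrored tiles are included, and actual isometries are
  built only at the end, by side-side-side.\<close>

definition is_tile :: "real \<Rightarrow> real \<Rightarrow> real \<Rightarrow> point set \<Rightarrow> bool" where
  "is_tile a b c U \<longleftrightarrow>
     (\<exists>P Q R. U = convex hull {P, Q, R} \<and> dist Q R = a \<and> dist P R = b \<and> dist P Q = c)"

text \<open>An upper bound on the count and no condition on overlaps make covers trivial to unite;
  exactness and disjointness are recovered from area in \<open>tiling_of_cover\<close>.\<close>

definition tile_cover :: "real \<Rightarrow> real \<Rightarrow> real \<Rightarrow> nat \<Rightarrow> point set \<Rightarrow> bool" where
  "tile_cover a b c n S \<longleftrightarrow>
     (\<exists>\<T>. finite \<T> \<and> card \<T> \<le> n \<and> \<Union>\<T> = S \<and> (\<forall>U\<in>\<T>. is_tile a b c U))"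

lemma is_tile_swap: "is_tile a b c U \<Longrightarrow> is_tile b a c U"
proof -
  assume "is_tile a b c U"
  then obtain P Q R where "U = convex hull {P, Q, R}" "dist Q R = a" "dist P R = b" "dist P Q = c"
    unfolding is_tile_def by blast
  then show ?thesis
    unfolding is_tile_def
    by (intro exI[of _ Q] exI[of _ P] exI[of _ R]) (simp add: dist_commute insert_commute)
qed

lemma tile_cover_swap: "tile_cover a b c n S \<Longrightarrow> tile_cover b a c n S"
  unfolding tile_cover_def using is_tile_swap by blast

lemma is_tile_hull:
  assumes "norm e = c" "norm f = b" "norm (e - f) = a"
  shows "is_tile a b c (convex hull {p, p + e, p + f})"
  unfolding is_tile_def
  by (rule exI[of _ p], rule exI[of _ "p + e"], rule exI[of _ "p + f"])
    (use assms in \<open>simp add: dist_norm\<close>)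

lemma is_tile_hull_minus:
  assumes "norm e = c" "norm f = b" "norm (e - f) = a"
  shows "is_tile a b c (convex hull {p, p - e, p - f})"
  using is_tile_hull[of "- e" c "- f" b a p] assms by (simp add: norm_minus_commute)

lemma tile_cover_Un:
  assumes "tile_cover a b c m S" "tile_cover a b c n T"
  shows "tile_cover a b c (m + n) (S \<union> T)"
proof -
  from assms obtain \<S> \<T> where
    "finite \<S>" "card \<S> \<le> m" "\<Union>\<S> = S" "\<forall>U\<in>\<S>. is_tile a b c U"
    "finite \<T>" "card \<T> \<le> n" "\<Union>\<T> = T" "\<forall>U\<in>\<T>. is_tile a b c U"
    unfolding tile_cover_def by blast
  then show ?thesis
    unfolding tile_cover_def
    by (intro exI[of _ "\<S> \<union> \<T>"]) (auto intro: order_trans[OF card_Un_le])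
qed

lemma tile_cover_UN:
  assumes "finite I" "\<And>i. i \<in> I \<Longrightarrow> is_tile a b c (g i)"
  shows "tile_cover a b c (card I) (\<Union>i\<in>I. g i)"
  unfolding tile_cover_def
  by (rule exI[of _ "g ` I"]) (use assms card_image_le in auto)

section \<open>Lattice covers of enlarged triangles and of parallelograms\<close>

lemma hull_triangle:
  fixes p :: "'a::real_vector"
  shows "convex hull {p, p + e, p + f} =
    {p + u *\<^sub>R e + v *\<^sub>R f | u v. 0 \<le> u \<and> 0 \<le> v \<and> u + v \<le> 1}"
  by (simp add: convex_hull_3_alt)

lemma nat_unit_interval:
  fixes x :: real
  assumes "0 \<le> x" "x \<le> n" "n > 0"
  obtains i :: nat where "i < n" "i \<le> x" "x \<le> i + 1"
\<comment> \<open>The right end has floor \<open>n\<close>, outside the index range, so it goes into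
  the last cell, which is closed.\<close>
proof (cases "x = n")
  case True
  with that[of "n - 1"] assms show ?thesis by auto
next
  case False
  have "real (nat \<lfloor>x\<rfloor>) = of_int \<lfloor>x\<rfloor>" using assms by simp
  moreover have "of_int \<lfloor>x\<rfloor> \<le> x" "x \<le> of_int \<lfloor>x\<rfloor> + 1" by linarith+
  moreover have "real (nat \<lfloor>x\<rfloor>) < n" using False assms calculation by linarith
  ultimately show ?thesis using that[of "nat \<lfloor>x\<rfloor>"] by (simp only: of_nat_less_iff of_nat_add of_nat_1)
qed

text \<open>The unit cell with corner (r, s) is cut by the diagonal x + y = r + s + 1. This is the
  half next to that corner.\<close>

lemma hull_up:
  fixes p :: "'a::real_vector"
  assumes "r \<le> x" "s \<le> y" "x + y \<le> r + s + 1"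
  shows "p + x *\<^sub>R e + y *\<^sub>R f \<in>
    convex hull {p + r *\<^sub>R e + s *\<^sub>R f, p + r *\<^sub>R e + s *\<^sub>R f + e, p + r *\<^sub>R e + s *\<^sub>R f + f}"
  unfolding hull_triangle mem_Collect_eq
  by (rule exI[of _ "x - r"], rule exI[of _ "y - s"]) (use assms in \<open>simp add: algebra_simps\<close>)

text \<open>Negating the edge vectors and all coordinates is a point reflection, which turns one
  half cell into the other.\<close>

lemma hull_down:
  fixes p :: "'a::real_vector"
  assumes "x \<le> r" "y \<le> s" "r + s \<le> x + y + 1"
  shows "p + x *\<^sub>R e + y *\<^sub>R f \<in>
    convex hull {p + r *\<^sub>R e + s *\<^sub>R f, p + r *\<^sub>R e + s *\<^sub>R f - e, p + r *\<^sub>R e + s *\<^sub>R f - f}"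
  using hull_up[of "-r" "-x" "-s" "-y" p "-e" "-f"] assms by simp

lemma hull_upE:
  fixes p :: "'a::real_vector"
  assumes "z \<in> convex hull {p + r *\<^sub>R e + s *\<^sub>R f, p + r *\<^sub>R e + s *\<^sub>R f + e, p + r *\<^sub>R e + s *\<^sub>R f + f}"
  obtains x y where "z = p + x *\<^sub>R e + y *\<^sub>R f" "r \<le> x" "s \<le> y" "x + y \<le> r + s + 1"
proof -
  from assms obtain u v where "z = p + r *\<^sub>R e + s *\<^sub>R f + u *\<^sub>R e + v *\<^sub>R f" "0 \<le> u" "0 \<le> v" "u + v \<le> 1"
    unfolding hull_triangle by blast
  with that[of "r + u" "s + v"] show ?thesis by (simp add: algebra_simps)
qed

lemma hull_downE:
  fixes p :: "'a::real_vector"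
  assumes "z \<in> convex hull {p + r *\<^sub>R e + s *\<^sub>R f, p + r *\<^sub>R e + s *\<^sub>R f - e, p + r *\<^sub>R e + s *\<^sub>R f - f}"
  obtains x y where "z = p + x *\<^sub>R e + y *\<^sub>R f" "x \<le> r" "y \<le> s" "r + s \<le> x + y + 1"
proof -
  from assms obtain x y where "z = p + x *\<^sub>R (-e) + y *\<^sub>R (-f)" "-r \<le> x" "-s \<le> y" "x + y \<le> -r + -s + 1"
    using hull_upE[of z p "-r" "-e" "-s" "-f"] by auto
  with that[of "-x" "-y"] show ?thesis by simp
qed

text \<open>Lines parallel to the sides cut the \<open>n\<close>-fold enlargement into n(n+1)/2
  upward and n(n-1)/2 downward tiles.\<close>

lemma tile_cover_triangle:
  fixes n :: nat
  assumes "n > 0" and e: "norm e = c" "norm f = b" "norm (e - f) = a"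
  shows "tile_cover a b c (n\<^sup>2) (convex hull {p, p + real n *\<^sub>R e, p + real n *\<^sub>R f})"
proof -
  define up where "up i j = (let z = p + real i *\<^sub>R e + real j *\<^sub>R f in convex hull {z, z + e, z + f})" for i j :: nat
  define dn where "dn i j = (let z = p + real i *\<^sub>R e + real j *\<^sub>R f in convex hull {z, z - e, z - f})" for i j :: nat
  \<comment> \<open>The cells with \<open>i + j \<ge> n\<close>, reflected in the centre of the \<open>n \<times> n\<close> grid, index the
    downward tiles; this makes the count \<open>n\<^sup>2\<close> immediate.\<close>
  define g where "g = (\<lambda>(i, j). if i + j < n then up i j else dn (n - i) (n - j))"
  let ?I = "{..<n} \<times> {..<n}"
  let ?H = "convex hull {p, p + real n *\<^sub>R e, p + real n *\<^sub>R f}"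
  have H: "?H = {p + x *\<^sub>R e + y *\<^sub>R f | x y. 0 \<le> x \<and> 0 \<le> y \<and> x + y \<le> n}" (is "_ = ?R")
  proof (intro equalityI subsetI)
    fix z assume "z \<in> ?H"
    then obtain u v where z: "z = p + u *\<^sub>R real n *\<^sub>R e + v *\<^sub>R real n *\<^sub>R f" "0 \<le> u" "0 \<le> v" "u + v \<le> 1"
      unfolding hull_triangle by blast
    have "u * n + v * n \<le> n"
      using mult_right_mono[OF z(4), of "real n"] by (simp add: algebra_simps)
    with z show "z \<in> ?R"
      unfolding mem_Collect_eq by (intro exI[of _ "u * n"] exI[of _ "v * n"]) simp
  next
    fix z assume "z \<in> ?R"
    then obtain x y where z: "z = p + x *\<^sub>R e + y *\<^sub>R f" "0 \<le> x" "0 \<le> y" "x + y \<le> n" by blast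
    then show "z \<in> ?H"
      unfolding hull_triangle mem_Collect_eq using \<open>n > 0\<close>
      by (intro exI[of _ "x / n"] exI[of _ "y / n"]) (simp add: field_simps)
  qed
  have "(\<Union>i\<in>?I. g i) = ?H"
  proof (intro equalityI subsetI)
    fix z assume "z \<in> (\<Union>i\<in>?I. g i)"
    then obtain i j where ij: "i < n" "j < n" and z: "z \<in> g (i, j)" by blast
    show "z \<in> ?H"
    proof (cases "i + j < n")
      case True
      with z have "z \<in> up i j" by (simp add: g_def)
      then obtain x y :: real where "z = p + x *\<^sub>R e + y *\<^sub>R f" "i \<le> x" "j \<le> y" "x + y \<le> i + j + 1"
        unfolding up_def Let_def by (rule hull_upE) simp
      moreover have "real i + real j + 1 \<le> n" using True by linarith
      ultimately show ?thesis unfolding H mem_Collect_eq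
        by (intro exI[of _ x] exI[of _ y]) auto
    next
      case False
      with z have "z \<in> dn (n - i) (n - j)" by (simp add: g_def)
      then obtain x y where xy: "z = p + x *\<^sub>R e + y *\<^sub>R f" "x \<le> real (n - i)" "y \<le> real (n - j)"
          "real (n - i) + real (n - j) \<le> x + y + 1"
        unfolding dn_def Let_def by (rule hull_downE) simp
      \<comment> \<open>The far corner (n - i, n - j) lies on or below the hypotenuse x + y = n, and
        its coordinates are at least 1, so the downward tile stays in the quadrant.\<close>
      have "real (n - i) + real (n - j) \<le> n" "real (n - i) \<ge> 1" "real (n - j) \<ge> 1"
        using ij False by linarith+
      with xy show ?thesis unfolding H mem_Collect_eq
        by (intro exI[of _ x] exI[of _ y]) auto
    qed
  next
    fix z assume "z \<in> ?H"
    then obtain x y where z: "z = p + x *\<^sub>R e + y *\<^sub>R f" "0 \<le> x" "0 \<le> y" "x + y \<le> n"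
      unfolding H by blast
    obtain i :: nat where i: "i < n" "i \<le> x" "x \<le> i + 1"
      using nat_unit_interval[of x n] z \<open>n > 0\<close> by auto
    \<comment> \<open>As \<open>i \<le> x\<close>, the bound on x + y gives y at most n - i;
      choosing \<open>j\<close> below \<open>n - i\<close> yields i + j < n at once.\<close>
    obtain j :: nat where j: "j < n - i" "j \<le> y" "y \<le> j + 1"
      using nat_unit_interval[of y "n - i"] z i by auto
    show "z \<in> (\<Union>i\<in>?I. g i)"
    proof (cases "x + y \<le> real i + real j + 1")
      case True
      then have "z \<in> up i j" unfolding z(1) up_def Let_def using i j by (intro hull_up) auto
      moreover have "i + j < n" using j by linarith
      ultimately have "z \<in> g (i, j)" by (simp add: g_def)
      then show ?thesis using i j by (intro UN_I[of "(i, j)"]) auto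
    next
      case False
      then have lt: "i + j + 1 < n" using z by linarith
      \<comment> \<open>Downward tiles are named by their far corner, here (i + 1, j + 1); its
        reflection (n - (i + 1), n - (j + 1)) is the index under which \<open>g\<close> lists
        it.\<close>
      have "z \<in> dn (i + 1) (j + 1)" unfolding z(1) dn_def Let_def using i j False by (intro hull_down) auto
      moreover have "\<not> n - (i + 1) + (n - (j + 1)) < n" "n - (n - (i + 1)) = i + 1" "n - (n - (j + 1)) = j + 1"
        using lt by linarith+
      ultimately have "z \<in> g (n - (i + 1), n - (j + 1))" by (simp only: g_def prod.case if_False)
      then show ?thesis using lt by (intro UN_I[of "(n - (i + 1), n - (j + 1))"]) auto
    qed
  qed
  moreover have "is_tile a b c (g i)" for i
    by (cases i) (simp add: g_def up_def dn_def Let_def is_tile_hull[OF e] is_tile_hull_minus[OF e])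
  ultimately show ?thesis
    using tile_cover_UN[of ?I a b c g] by (simp add: power2_eq_square)
qed

text \<open>Each of the m n lattice cells is cut into two tiles by its diagonal parallel to
  \<open>e - f\<close>.\<close>

lemma tile_cover_parallelogram:
  fixes m n :: nat
  assumes "m > 0" "n > 0" and e: "norm e = c" "norm f = b" "norm (e - f) = a"
  shows "tile_cover a b c (2 * m * n)
    {p + x *\<^sub>R e + y *\<^sub>R f | x y. 0 \<le> x \<and> x \<le> m \<and> 0 \<le> y \<and> y \<le> n}" (is "tile_cover _ _ _ _ ?R")
proof -
  define up where "up i j = (let z = p + real i *\<^sub>R e + real j *\<^sub>R f in convex hull {z, z + e, z + f})" for i j :: nat
  define dn where "dn i j = (let z = p + real i *\<^sub>R e + real j *\<^sub>R f in convex hull {z, z - e, z - f})" for i j :: nat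
  define g where "g = (\<lambda>(i, j, k). if k then up i j else dn (Suc i) (Suc j))"
  let ?I = "{..<m} \<times> {..<n} \<times> (UNIV :: bool set)"
  have "(\<Union>i\<in>?I. g i) = ?R"
  proof (intro equalityI subsetI)
    fix z assume "z \<in> (\<Union>i\<in>?I. g i)"
    then obtain i j k where ij: "i < m" "j < n" and z: "z \<in> g (i, j, k)" by blast
    have r: "real i + 1 \<le> m" "real j + 1 \<le> n" using ij by linarith+
    show "z \<in> ?R"
    proof (cases k)
      case True
      with z have "z \<in> up i j" by (simp add: g_def)
      then obtain x y :: real where "z = p + x *\<^sub>R e + y *\<^sub>R f" "i \<le> x" "j \<le> y" "x + y \<le> i + j + 1"
        unfolding up_def Let_def by (rule hull_upE) simp
      with r show ?thesis unfolding mem_Collect_eq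
        by (intro exI[of _ x] exI[of _ y]) auto
    next
      case False
      with z have "z \<in> dn (Suc i) (Suc j)" by (simp add: g_def)
      then obtain x y where xy: "z = p + x *\<^sub>R e + y *\<^sub>R f" "x \<le> real (Suc i)" "y \<le> real (Suc j)"
          "real (Suc i) + real (Suc j) \<le> x + y + 1"
        unfolding dn_def Let_def by (rule hull_downE) simp
      with r show ?thesis unfolding mem_Collect_eq
        by (intro exI[of _ x] exI[of _ y]) auto
    qed
  next
    fix z assume "z \<in> ?R"
    then obtain x y where z: "z = p + x *\<^sub>R e + y *\<^sub>R f" "0 \<le> x" "0 \<le> y" "x \<le> m" "y \<le> n"
      by blast
    obtain i :: nat where i: "i < m" "i \<le> x" "x \<le> i + 1"
      using nat_unit_interval[of x m] z assms by auto
    obtain j :: nat where j: "j < n" "j \<le> y" "y \<le> j + 1"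
      using nat_unit_interval[of y n] z assms by auto
    show "z \<in> (\<Union>i\<in>?I. g i)"
    proof (cases "x + y \<le> real i + real j + 1")
      case True
      then have "z \<in> up i j" unfolding z(1) up_def Let_def using i j by (intro hull_up) auto
      then show ?thesis using i j by (intro UN_I[of "(i, j, True)"]) (auto simp: g_def)
    next
      case False
      have "z \<in> dn (Suc i) (Suc j)" unfolding z(1) dn_def Let_def using i j False by (intro hull_down) auto
      then show ?thesis using i j by (intro UN_I[of "(i, j, False)"]) (auto simp: g_def)
    qed
  qed
  moreover have "is_tile a b c (g i)" for i
    by (cases i) (simp add: g_def up_def dn_def Let_def is_tile_hull[OF e] is_tile_hull_minus[OF e])
  ultimately show ?thesis
    using tile_cover_UN[of ?I a b c g] by (simp add: mult.commute mult.left_commute)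
qed

section \<open>From covers to tilings\<close>

lemma measure_triangle_hull:
  fixes A B C :: point
  shows "measure lebesgue (convex hull {A, B, C}) = measure lborel (convex hull {A, B, C})"
  by (intro measure_completion)
    (simp add: compact_imp_closed finite_imp_compact_convex_hull)

text \<open>By Heron's formula the side lengths determine the area.\<close>

lemma measure_is_tile_cong:
  assumes "is_tile a b c U" "is_tile a b c V"
  shows "measure lebesgue U = measure lebesgue V"
proof -
  have "measure lebesgue W = sqrt ((a + b + c) / 2 * ((a + b + c) / 2 - a) * ((a + b + c) / 2 - b) * ((a + b + c) / 2 - c))"
    if "is_tile a b c W" for W
  proof -
    from that obtain P Q R where "W = convex hull {P, Q, R}" "dist Q R = a" "dist P R = b" "dist P Q = c"
      unfolding is_tile_def by blast
    with heron[of P Q R] show ?thesis by (simp only: measure_triangle_hull)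
  qed
  with assms show ?thesis by simp
qed

section \<open>The plane determinant and side-side-side congruence\<close>

definition cross2 :: "point \<Rightarrow> point \<Rightarrow> real" where
  "cross2 x y = x $ 1 * y $ 2 - x $ 2 * y $ 1"

lemma cross2_scaleR: "cross2 (r *\<^sub>R x) (s *\<^sub>R y) = r * s * cross2 x y"
  by (simp add: cross2_def algebra_simps)

lemma measure_hull_cross2:
  "measure lebesgue (convex hull {p, p + e, p + f}) = \<bar>cross2 e f\<bar> / 2"
proof -
  have "f $ 1 * e $ 2 - e $ 1 * f $ 2 = - cross2 e f" by (simp add: cross2_def algebra_simps)
  then show ?thesis by (simp add: measure_triangle_hull content_triangle)
qed

text \<open>Lagrange's identity turns a vanishing determinant into the equality case of
  Cauchy-Schwarz.\<close>

lemma cross2_eq_0_iff: "cross2 x y = 0 \<longleftrightarrow> collinear {0, x, y}"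
proof -
  have "(cross2 x y)\<^sup>2 + (x \<bullet> y)\<^sup>2 = (norm x * norm y)\<^sup>2"
    unfolding power_mult_distrib power2_norm_eq_inner
    by (simp add: cross2_def inner_vec_def sum_2 power2_eq_square algebra_simps)
  then have "(cross2 x y)\<^sup>2 = 0 \<longleftrightarrow> (x \<bullet> y)\<^sup>2 = (norm x * norm y)\<^sup>2" by linarith
  also have "\<dots> \<longleftrightarrow> \<bar>x \<bullet> y\<bar> = \<bar>norm x * norm y\<bar>" by (simp only: power2_eq_iff abs_eq_iff)
  finally show ?thesis by (simp add: norm_cauchy_schwarz_equal)
qed

lemma collinear_translate: "collinear {p, p + e, p + f} \<longleftrightarrow> collinear {0, e, f :: 'a::real_inner}"
proof -
  have "collinear {p, p + e, p + f} \<longleftrightarrow> collinear {p + e, p, p + f}" by (simp add: insert_commute)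
  also have "\<dots> \<longleftrightarrow> collinear {0, e, f}"
    by (subst collinear_3) (simp_all add: NO_MATCH_def)
  finally show ?thesis .
qed

text \<open>Cramer's rule for the coordinates of \<open>x\<close> in the basis \<open>e\<close>,
  \<open>f\<close>.\<close>

lemma cross2_expand:
  assumes "cross2 e f \<noteq> 0"
  shows "x = (cross2 x f / cross2 e f) *\<^sub>R e + (cross2 e x / cross2 e f) *\<^sub>R f"
proof -
  have "cross2 e f * x $ i = cross2 x f * e $ i + cross2 e x * f $ i" for i
    using exhaust_2[of i] by (auto simp: cross2_def algebra_simps)
  then show ?thesis using assms by (simp add: vec_eq_iff field_simps)
qed

text \<open>Three side lengths fix the inner product of two edge vectors. So the linear map taking
  the edges \<open>e\<close>, \<open>f\<close> to \<open>e'\<close>, \<open>f'\<close> preserves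
  norms; Cramer coordinates define it on the whole plane, as \<open>congruent_figs\<close>
  demands.\<close>

lemma congruent_triangle_hulls:
  fixes P Q R X Y Z :: point
  assumes nc: "\<not> collinear {P, Q, R}"
    and d: "dist Y Z = dist Q R" "dist X Z = dist P R" "dist X Y = dist P Q"
  shows "congruent_figs (convex hull {X, Y, Z}) (convex hull {P, Q, R})"
proof -
  define e f e' f' where defs: "e = Q - P" "f = R - P" "e' = Y - X" "f' = Z - X"
  have cr: "cross2 e f \<noteq> 0"
    using nc collinear_translate[of P e f] by (simp add: cross2_eq_0_iff defs)
  have n: "norm e' = norm e" "norm f' = norm f" "norm (e' - f') = norm (e - f)"
    using d by (simp_all add: defs dist_norm norm_minus_commute)
  have ip: "e' \<bullet> f' = e \<bullet> f"
  proof -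
    have "(norm (e' - f'))\<^sup>2 = (norm (e - f))\<^sup>2" "(norm e')\<^sup>2 = (norm e)\<^sup>2" "(norm f')\<^sup>2 = (norm f)\<^sup>2"
      using n by simp_all
    then show ?thesis
      unfolding power2_norm_eq_inner by (simp add: inner_diff inner_commute)
  qed
  define L where "L x = (cross2 x f / cross2 e f) *\<^sub>R e' + (cross2 e x / cross2 e f) *\<^sub>R f'" for x
  have lin: "linear L"
    by (rule linearI) (simp_all add: L_def cross2_def algebra_simps add_divide_distrib diff_divide_distrib)
  have nL: "norm (L x) = norm x" for x
  proof -
    obtain u v where u: "u = cross2 x f / cross2 e f" and v: "v = cross2 e x / cross2 e f" by blast
    have x: "x = u *\<^sub>R e + v *\<^sub>R f" using cross2_expand[OF cr] u v by blast
    have "e' \<bullet> e' = e \<bullet> e" "f' \<bullet> f' = f \<bullet> f" using n by (simp_all add: norm_eq_sqrt_inner)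
    then have "(u *\<^sub>R e' + v *\<^sub>R f') \<bullet> (u *\<^sub>R e' + v *\<^sub>R f') = (u *\<^sub>R e + v *\<^sub>R f) \<bullet> (u *\<^sub>R e + v *\<^sub>R f)"
      using ip by (simp add: inner_add inner_commute)
    moreover have "L x = u *\<^sub>R e' + v *\<^sub>R f'" by (simp only: L_def u v)
    ultimately have "L x \<bullet> L x = x \<bullet> x" by (simp only: x[symmetric])
    then show ?thesis by (simp add: norm_eq_sqrt_inner)
  qed
  have Lef: "L e = e'" "L f = f'" using cr by (simp_all add: L_def cross2_def)
  define F where "F x = X + L (x - P)" for x
  have "dist (F x) (F y) = dist x y" for x y
    using nL[of "x - y"] linear_diff[OF lin, of "x - P" "y - P"] by (simp add: F_def dist_norm)
  moreover have "F ` (convex hull {P, Q, R}) = convex hull {X, Y, Z}"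
  proof -
    have "F = (\<lambda>x. (X - L P) + x) \<circ> L"
      using linear_diff[OF lin] by (auto simp: F_def)
    then have "F ` (convex hull {P, Q, R}) = convex hull (F ` {P, Q, R})"
      by (simp only: image_comp[symmetric] convex_hull_linear_image[OF lin] convex_hull_translation)
    also have "F ` {P, Q, R} = {X, Y, Z}"
      using Lef linear_0[OF lin] by (simp add: F_def defs)
    finally show ?thesis .
  qed
  ultimately show ?thesis unfolding congruent_figs_def by blast
qed

text \<open>A closed convex set with interior points is the closure of its interior, so an open set
  disjoint from the interior misses the whole set.\<close>

lemma Int_subset_frontiers:
  fixes U V :: "'a::euclidean_space set"
  assumes "convex U" "convex V" "closed U" "closed V" "interior U \<noteq> {}" "interior V \<noteq> {}"
    and dis: "interior U \<inter> interior V = {}"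
  shows "U \<inter> V \<subseteq> frontier U \<inter> frontier V"
proof -
  have "U = closure (interior U)" "V = closure (interior V)"
    using assms by (simp_all add: convex_closure_interior)
  then have "interior U \<inter> V = {}" "U \<inter> interior V = {}"
    using dis open_Int_closure_eq_empty[of "interior U" "interior V"]
      open_Int_closure_eq_empty[of "interior V" "interior U"] by (auto simp: Int_commute)
  then show ?thesis using assms by (auto simp: frontier_def)
qed

text \<open>A cover by at most \<open>N\<close> tiles of a set whose area is that of \<open>N\<close> tiles has no room for
  overlaps, so disjointness of the tiles need not be checked piece by piece.\<close>

lemma tiling_of_cover:
  fixes P Q R :: point
  assumes cov: "tile_cover a b c N S"
    and tri: "triangle_with_sides P Q R a b c"
    and area: "measure lebesgue S = N * measure lebesgue (convex hull {P, Q, R})"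
  shows "\<exists>\<T>. is_tiling N S (convex hull {P, Q, R}) \<T>"
proof -
  define m where "m = measure lebesgue (convex hull {P, Q, R})"
  have nc: "\<not> collinear {P, Q, R}" and d: "dist Q R = a" "dist P R = b" "dist P Q = c"
    using tri by (auto simp: triangle_with_sides_def)
  have T: "is_tile a b c (convex hull {P, Q, R})" unfolding is_tile_def using d by blast
  have m: "m > 0"
  proof -
    have "cross2 (Q - P) (R - P) \<noteq> 0"
      using nc collinear_translate[of P "Q - P" "R - P"] by (simp add: cross2_eq_0_iff)
    then show ?thesis using measure_hull_cross2[of P "Q - P" "R - P"] by (simp add: m_def)
  qed
  from cov obtain \<T> where \<T>: "finite \<T>" "card \<T> \<le> N" "\<Union>\<T> = S" "\<And>U. U \<in> \<T> \<Longrightarrow> is_tile a b c U"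
    unfolding tile_cover_def by blast
  have meas: "measure lebesgue U = m" if "U \<in> \<T>" for U
    using measure_is_tile_cong[OF \<T>(4)[OF that] T] by (simp add: m_def)
  have cpt: "compact U" "convex U" if "U \<in> \<T>" for U
    using \<T>(4)[OF that] by (auto simp: is_tile_def finite_imp_compact_convex_hull)
  have lm: "U \<in> lmeasurable" if "U \<in> \<T>" for U
    using cpt[OF that] by (simp add: lmeasurable_compact)
  have sum: "measure lebesgue (\<Union>\<U>) \<le> card \<U> * m" if "\<U> \<subseteq> \<T>" for \<U>
  proof -
    have "measure lebesgue (\<Union>\<U>) \<le> (\<Sum>U\<in>\<U>. measure lebesgue U)"
      using that \<T>(1) lm by (intro measure_Union_le) (auto intro: finite_subset fmeasurableD)
    also have "\<dots> = card \<U> * m"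
      using that meas by (simp add: subset_iff)
    finally show ?thesis .
  qed
  have S: "measure lebesgue (\<Union>\<T>) = N * m" using \<T>(3) area by (simp add: m_def)
  \<comment> \<open>Fewer than \<open>N\<close> tiles of area m > 0 could not reach total area N
    m.\<close>
  then have card: "card \<T> = N"
    using sum[of \<T>] \<T>(2) m by (simp add: le_antisym)
  have int: "interior U \<noteq> {}" if "U \<in> \<T>" for U
  proof
    assume "interior U = {}"
    then have "negligible U" using negligible_convex_interior cpt[OF that] by blast
    then show False using meas[OF that] m negligible_imp_measure0 by force
  qed
  \<comment> \<open>Otherwise the two tiles share positive area and cover less than 2 m together;
    the other N - 2 tiles cannot make up the loss.\<close>
  have dis: "interior U \<inter> interior V = {}" if UV: "U \<in> \<T>" "V \<in> \<T>" "U \<noteq> V" for U V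
  proof (rule ccontr)
    assume "interior U \<inter> interior V \<noteq> {}"
    then have "\<not> negligible (U \<inter> V)"
      using open_not_negligible[of "interior U \<inter> interior V"]
        negligible_subset[OF _ Int_mono[OF interior_subset[of U] interior_subset[of V]]] by blast
    moreover have "U \<inter> V \<in> lmeasurable" using lm UV by (simp add: fmeasurable.Int fmeasurableD)
    ultimately have pos: "measure lebesgue (U \<inter> V) > 0"
      by (simp add: negligible_iff_measure zero_less_measure_iff)
    have "measure lebesgue (\<Union>\<T>) = measure lebesgue ((U \<union> V) \<union> \<Union>(\<T> - {U, V}))"
      using UV by (intro arg_cong[where f = "measure lebesgue"]) blast
    also have "\<dots> \<le> measure lebesgue (U \<union> V) + measure lebesgue (\<Union>(\<T> - {U, V}))"
      using \<T>(1) lm UV by (intro measure_Un_le sets.Un sets.finite_Union) (auto intro: fmeasurableD)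
    also have "measure lebesgue (U \<union> V) < 2 * m"
      using measure_Un3[OF lm[OF UV(1)] lm[OF UV(2)]] meas UV pos by simp
    also have "measure lebesgue (\<Union>(\<T> - {U, V})) \<le> card (\<T> - {U, V}) * m" by (rule sum) auto
    also have "card (\<T> - {U, V}) = N - 2" using UV \<T>(1) card by (simp add: card_Diff_subset)
    \<comment> \<open>Guards the truncated subtraction in \<open>N - 2\<close>.\<close>
    also have "N \<ge> 2" using card_mono[of \<T> "{U, V}"] UV \<T>(1) card by simp
    then have "2 * m + real (N - 2) * m = N * m" by (simp add: algebra_simps of_nat_diff)
    finally show False using S by simp
  qed
  have "congruent_figs U (convex hull {P, Q, R})" if "U \<in> \<T>" for U
    using \<T>(4)[OF that] d unfolding is_tile_def by (auto intro: congruent_triangle_hulls[OF nc])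
  moreover have "U \<inter> V \<subseteq> frontier U \<inter> frontier V" if "U \<in> \<T>" "V \<in> \<T>" "U \<noteq> V" for U V
    using Int_subset_frontiers[OF cpt(2)[OF that(1)] cpt(2)[OF that(2)]] dis[OF that]
      compact_imp_closed[OF cpt(1)] int that by simp
  ultimately show ?thesis
    unfolding is_tiling_def using \<T> card by blast
qed

section \<open>The triquadratic dissection\<close>

text \<open>Below, \<open>p\<close> and \<open>q\<close> are the vectors of length \<open>c\<close> along \<open>AB\<close> and \<open>AC\<close>, and \<open>r\<close> is the vector
  of length \<open>b\<close> along the bisector at \<open>A\<close>; the point \<open>O\<close> is \<open>A + b r\<close>.\<close>

lemma triquadratic_norms:
  fixes a b c :: real and p q :: "'a::real_inner"
  assumes pos: "0 < a" "0 < b" "0 < c" and eq: "a\<^sup>2 + b * c = c\<^sup>2"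
    and p: "norm p = c" and q: "norm q = c" and pq: "norm (c *\<^sub>R p - b *\<^sub>R q) = a * (b + c)"
  defines "r \<equiv> (b / (b + c)) *\<^sub>R (p + q)"
  shows "norm r = b" "norm (p - r) = a" "norm (q - r) = a"
proof -
  have pp: "p \<bullet> p = c\<^sup>2" and qq: "q \<bullet> q = c\<^sup>2" using p q by (simp_all add: dot_square_norm)
  \<comment> \<open>Law of cosines in ABC: the vector is B - C, and its length determines the inner
    product of \<open>p\<close> and \<open>q\<close>.\<close>
  have "(a * (b + c))\<^sup>2 = (c *\<^sub>R p - b *\<^sub>R q) \<bullet> (c *\<^sub>R p - b *\<^sub>R q)" using pq by (simp add: dot_square_norm)
  also have "\<dots> = c\<^sup>2 * (p \<bullet> p) + b\<^sup>2 * (q \<bullet> q) - 2 * b * c * (p \<bullet> q)"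
    by (simp add: inner_diff inner_commute power2_eq_square algebra_simps)
  finally have "2 * b * c * (p \<bullet> q) = c\<^sup>2 * c\<^sup>2 + b\<^sup>2 * c\<^sup>2 - a\<^sup>2 * (b + c)\<^sup>2"
    by (simp add: pp qq power_mult_distrib)
  also have "a\<^sup>2 = c\<^sup>2 - b * c" using eq by simp
  finally have "b * c * (2 * (p \<bullet> q)) = b * c * (2 * b * c - c\<^sup>2 + b\<^sup>2)" by algebra
  then have g: "2 * (p \<bullet> q) = 2 * b * c - c\<^sup>2 + b\<^sup>2" using pos by simp
  have s: "b + c \<noteq> 0" using pos by simp
  \<comment> \<open>Since \<open>p\<close> and \<open>q\<close> have equal length, p + q points
    along the bisector; its length b + c explains the factor b / (b + c) in
    \<open>r\<close>.\<close>
  have "(p + q) \<bullet> (p + q) = (b + c)\<^sup>2"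
    using g by (simp add: inner_add inner_commute pp qq power2_eq_square algebra_simps)
  then have rr: "r \<bullet> r = b\<^sup>2" unfolding r_def using s by (simp add: power2_eq_square)
  have d: "norm (x - r) = a" if x: "x \<bullet> x = c\<^sup>2" "2 * (x \<bullet> (p + q)) = (b + c)\<^sup>2" for x
  proof -
    have "2 * (x \<bullet> r) = (b / (b + c)) * (2 * (x \<bullet> (p + q)))" by (simp add: r_def)
    also have "\<dots> = b * (b + c)" unfolding x(2) using s by (simp add: power2_eq_square)
    finally have "(x - r) \<bullet> (x - r) = c\<^sup>2 + b\<^sup>2 - b * (b + c)"
      by (simp add: inner_diff inner_commute x(1) rr)
    also have "\<dots> = a\<^sup>2" using eq by (simp add: power2_eq_square algebra_simps)
    finally show ?thesis using pos by (simp add: norm_eq_sqrt_inner)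
  qed
  show "norm r = b" using rr pos by (simp add: norm_eq_sqrt_inner)
  have h: "2 * (p \<bullet> (p + q)) = (b + c)\<^sup>2" "2 * (q \<bullet> (p + q)) = (b + c)\<^sup>2"
    using g by (simp_all add: inner_add inner_commute pp qq power2_eq_square algebra_simps)
  show "norm (p - r) = a" "norm (q - r) = a"
    using d[of p] d[of q] h pp qq by auto
qed

text \<open>This is an affine fact: in coordinates (s, t) along \<open>p\<close> and
  \<open>q\<close> every piece is cut out by linear inequalities. The four pieces are AXO, ACO, COY
  and XBYO, in this order.\<close>

lemma triquadratic_dissection:
  fixes b c :: real and p q A :: "'a::real_vector"
  assumes bc: "0 < b" "b < c"
  defines "r \<equiv> (b / (b + c)) *\<^sub>R (p + q)"
  defines "B \<equiv> A + c *\<^sub>R p" and "C \<equiv> A + b *\<^sub>R q"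
  shows "convex hull {A, B, C} =
    convex hull {A, A + b *\<^sub>R p, A + b *\<^sub>R r} \<union> convex hull {A, A + b *\<^sub>R q, A + b *\<^sub>R r} \<union>
    convex hull {C, C + (c / (b + c)) *\<^sub>R (c *\<^sub>R p - b *\<^sub>R q), C + b *\<^sub>R (r - q)} \<union>
    {B + x *\<^sub>R (- p) + y *\<^sub>R (r - p) | x y. 0 \<le> x \<and> x \<le> c - b \<and> 0 \<le> y \<and> y \<le> b}"
    (is "?S = ?P1 \<union> ?P2 \<union> ?P3 \<union> ?P4")
proof -
  define k where "k = b / (b + c)"
  have k: "0 < k" "k < 1" "k * (b + c) = b" using bc by (simp_all add: k_def)
  have r: "r = k *\<^sub>R p + k *\<^sub>R q" by (simp add: r_def k_def scaleR_add_right)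
  have inS: "A + s *\<^sub>R p + t *\<^sub>R q \<in> ?S" if "0 \<le> s" "0 \<le> t" "b * s + c * t \<le> b * c" for s t
    unfolding B_def C_def hull_triangle mem_Collect_eq using that bc
    by (intro exI[of _ "s / c"] exI[of _ "t / b"]) (simp add: field_simps)
  have S_E: "\<exists>s t. z = A + s *\<^sub>R p + t *\<^sub>R q \<and> 0 \<le> s \<and> 0 \<le> t \<and> b * s + c * t \<le> b * c" if "z \<in> ?S" for z
  proof -
    from that obtain u v where z: "z = A + u *\<^sub>R c *\<^sub>R p + v *\<^sub>R b *\<^sub>R q" "0 \<le> u" "0 \<le> v" "u + v \<le> 1"
      unfolding B_def C_def hull_triangle by blast
    have "(b * c) * (u + v) \<le> b * c" using mult_left_mono[OF z(4), of "b * c"] bc by simp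
    with z bc show ?thesis
      by (intro exI[of _ "u * c"] exI[of _ "v * b"]) (simp add: algebra_simps)
  qed
  show ?thesis
  proof (intro equalityI Un_least)
    have pts: "A \<in> ?S" "A + b *\<^sub>R p \<in> ?S" "A + b *\<^sub>R q \<in> ?S" "C \<in> ?S"
      using inS[of 0 0] inS[of b 0] inS[of 0 b] bc by (simp_all add: C_def)
    have O: "A + b *\<^sub>R r \<in> ?S"
    proof -
      have "b * (b * k) + c * (b * k) = b * (k * (b + c))" by (simp add: algebra_simps)
      also have "\<dots> \<le> b * c" using k bc by simp
      finally show ?thesis
        using inS[of "b * k" "b * k"] k bc by (simp add: r scaleR_add_right add.assoc)
    qed
    have Y: "C + (c / (b + c)) *\<^sub>R (c *\<^sub>R p - b *\<^sub>R q) \<in> ?S"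
    proof -
      define l where "l = c / (b + c)"
      have l: "0 \<le> l" "l \<le> 1" using bc by (simp_all add: l_def)
      have "A + (l * c) *\<^sub>R p + (b - l * b) *\<^sub>R q \<in> ?S"
        using l bc by (intro inS) (simp_all add: algebra_simps mult_left_le)
      then show ?thesis unfolding C_def l_def[symmetric] by (simp add: algebra_simps)
    qed
    have "C + b *\<^sub>R (r - q) = A + b *\<^sub>R r" by (simp add: C_def algebra_simps)
    with O have O': "C + b *\<^sub>R (r - q) \<in> ?S" by simp
    show "?P1 \<subseteq> ?S" "?P2 \<subseteq> ?S" "?P3 \<subseteq> ?S"
      using pts O Y O' by (intro hull_minimal; simp)+
    show "?P4 \<subseteq> ?S"
    proof
      fix z assume "z \<in> ?P4"
      then obtain x y where z: "z = B + x *\<^sub>R (- p) + y *\<^sub>R (r - p)"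
        and xy: "0 \<le> x" "x \<le> c - b" "0 \<le> y" "y \<le> b" by blast
      define s t where "s = c - x - y + y * k" and "t = y * k"
      have "z = A + s *\<^sub>R p + t *\<^sub>R q" by (simp add: z s_def t_def B_def r algebra_simps)
      moreover have "0 \<le> s"
      proof -
        have "y * (1 - k) \<le> b * 1" using xy k bc by (intro mult_mono) auto
        then show ?thesis using xy by (simp add: s_def algebra_simps)
      qed
      moreover have "0 \<le> t" using xy k by (simp add: t_def)
      moreover have "b * s + c * t \<le> b * c"
      proof -
        have "b * s + c * t = b * c - b * x - b * y + y * (k * (b + c))"
          by (simp add: s_def t_def algebra_simps)
        then show ?thesis using k xy bc by (simp add: mult.commute)
      qed
      ultimately show "z \<in> ?S" using inS by simp
    qed
    show "?S \<subseteq> ?P1 \<union> ?P2 \<union> ?P3 \<union> ?P4"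
    proof
      fix z assume "z \<in> ?S"
      with S_E obtain s t where z: "z = A + s *\<^sub>R p + t *\<^sub>R q"
        and st: "0 \<le> s" "0 \<le> t" "b * s + c * t \<le> b * c" by blast
      \<comment> \<open>With equality, \<open>t = s\<close> is the line AO,
        \<open>b * s + c * t = b\<^sup>2\<close> is XO, \<open>c * s + b * t = b\<^sup>2\<close> is
        CO and \<open>t * (b + c) = b\<^sup>2\<close> is OY. On each side of AO, case 1 or 2 bounds
        the smaller of the two forms; beyond it both forms are at least \<open>b\<^sup>2\<close>,
        and OY separates 3 from 4.\<close>
      consider (1) "t \<le> s" "b * s + c * t \<le> b\<^sup>2" | (2) "s \<le> t" "c * s + b * t \<le> b\<^sup>2"
        | (3) "b\<^sup>2 \<le> t * (b + c)" "b\<^sup>2 \<le> c * s + b * t" | (4) "t * (b + c) \<le> b\<^sup>2" "b\<^sup>2 \<le> b * s + c * t"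
      proof -
        have "(c - b) * t \<le> (c - b) * s" if "t \<le> s" using that bc by (simp add: mult_left_mono)
        moreover have "(c - b) * s \<le> (c - b) * t" if "s \<le> t" using that bc by (simp add: mult_left_mono)
        ultimately show ?thesis using that by (smt (verit) left_diff_distrib)
      qed
      then show "z \<in> ?P1 \<union> ?P2 \<union> ?P3 \<union> ?P4"
      proof cases
        case 1
        \<comment> \<open>Solve z - A = u b p + v b r: the coefficient of \<open>q\<close> gives
          \<open>v\<close>, then that of \<open>p\<close> gives \<open>u\<close>.\<close>
        obtain u v where uv: "u = (s - t) / b" "v = t / (b * k)" by blast
        have s: "s = u * b + v * (b * k)" and t: "t = v * (b * k)"
          using bc k by (simp_all add: uv)
        have "z = A + u *\<^sub>R b *\<^sub>R p + v *\<^sub>R b *\<^sub>R r"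
          by (simp add: z r s t algebra_simps)
        moreover have "0 \<le> u" "0 \<le> v" using 1 st bc k by (simp_all add: uv)
        moreover have "u + v \<le> 1"
        proof -
          have "b\<^sup>2 * (u + v) = b * s + c * t" using s t k(3) by algebra
          then have "b\<^sup>2 * (u + v) \<le> b\<^sup>2 * 1" using 1 by simp
          then show ?thesis using bc by simp
        qed
        ultimately have "z \<in> ?P1" unfolding hull_triangle by blast
        then show ?thesis by blast
      next
        case 2
        obtain u v where uv: "u = (t - s) / b" "v = s / (b * k)" by blast
        have s: "t = u * b + v * (b * k)" and t: "s = v * (b * k)"
          using bc k by (simp_all add: uv)
        have "z = A + u *\<^sub>R b *\<^sub>R q + v *\<^sub>R b *\<^sub>R r"
          by (simp add: z r s t algebra_simps)
        moreover have "0 \<le> u" "0 \<le> v" using 2 st bc k by (simp_all add: uv)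
        moreover have "u + v \<le> 1"
        proof -
          have "b\<^sup>2 * (u + v) = c * s + b * t" using s t k(3) by algebra
          then have "b\<^sup>2 * (u + v) \<le> b\<^sup>2 * 1" using 2 by simp
          then show ?thesis using bc by simp
        qed
        ultimately have "z \<in> ?P2" unfolding hull_triangle by blast
        then show ?thesis by blast
      next
        case 3
        \<comment> \<open>Barycentric weights of Y and O: \<open>u\<close> vanishes on CO and is 1
          at Y, while \<open>v\<close> vanishes on BC and is 1 at O.\<close>
        obtain u v l where uv: "u = (c * s - b\<^sup>2 + b * t) / (c * (c - b))" 
          "v = (b * c - c * t - b * s) / (b * (c - b))" "l = c / (b + c)" by blast
        have uv': "c * (c - b) * u = c * s - b\<^sup>2 + b * t" "b * (c - b) * v = b * c - c * t - b * s"
          "l * (b + c) = c" using bc by (simp_all add: uv)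
        have s: "s = u * l * c + v * b * k" and t: "t = b - u * l * b + v * b * k - v * b"
        proof -
          have "(b + c) * (c - b) * s = (b + c) * (c - b) * (u * l * c + v * b * k)"
            "(b + c) * (c - b) * t = (b + c) * (c - b) * (b - u * l * b + v * b * k - v * b)"
            using uv' k(3) by algebra+
          then show "s = u * l * c + v * b * k" "t = b - u * l * b + v * b * k - v * b"
            using bc by auto
        qed
        have "z = C + u *\<^sub>R (c / (b + c)) *\<^sub>R (c *\<^sub>R p - b *\<^sub>R q) + v *\<^sub>R b *\<^sub>R (r - q)"
          unfolding uv(3)[symmetric] by (simp add: z r s t C_def algebra_simps)
        moreover have "0 \<le> u" "0 \<le> v" using 3 st bc by (simp_all add: uv algebra_simps)
        moreover have "u + v \<le> 1"
        proof -
          have "(c - b) * (b * c * (u + v)) = (c - b) * ((b + c) * (b - t))" using uv' by algebra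
          then have "b * c * (u + v) = (b + c) * (b - t)" using bc by simp
          also have "\<dots> \<le> b * c * 1" using 3 by (simp add: power2_eq_square algebra_simps)
          finally show ?thesis using bc by simp
        qed
        ultimately have "z \<in> ?P3" unfolding hull_triangle by blast
        then show ?thesis by blast
      next
        case 4
        \<comment> \<open>\<open>x\<close> is 0 on BC and c - b on XO; \<open>y\<close> is 0 on AB
          and b on OY.\<close>
        obtain x y where xy: "x = c - s - t * c / b" "y = t / k" by blast
        have t: "t = y * k" and s: "s = c - x - y + y * k"
        proof -
          show t: "t = y * k" using k by (simp add: xy)
          have "b * x = b * c - b * s - c * t" using bc by (simp add: xy algebra_simps)
          then have "b * s = b * (c - x - y + y * k)" using t k(3) by algebra
          then show "s = c - x - y + y * k" using bc by simp
        qed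
        have "z = B + x *\<^sub>R (- p) + y *\<^sub>R (r - p)"
          by (simp add: z r s t B_def algebra_simps)
        moreover have "0 \<le> x" "x \<le> c - b" "0 \<le> y" "y \<le> b"
        proof -
          have bx: "b * x = b * c - (b * s + c * t)" and yb: "y * b = t * (b + c)"
            using s t k(3) by algebra+
          from bx st have "0 \<le> b * x" by simp
          then show "0 \<le> x" using bc by (simp add: zero_le_mult_iff)
          from bx 4 have "b * x \<le> b * (c - b)" by (simp add: power2_eq_square algebra_simps)
          then show "x \<le> c - b" using bc by simp
          show "0 \<le> y" using st k by (simp add: xy)
          from yb 4 have "y * b \<le> b * b" by (simp add: power2_eq_square)
          then show "y \<le> b" using bc by simp
        qed
        ultimately have "z \<in> ?P4" by blast
        then show ?thesis by blast
      qed
    qed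
  qed
qed

text \<open>This is the vector from O to Y: it is parallel to AB, and its length (c - b) c will
  equal the square of \<open>a\<close>.\<close>

lemma triquadratic_short_edge:
  fixes b c :: real and p q :: "'a::real_vector"
  assumes s: "b + c \<noteq> 0"
  shows "(c / (b + c)) *\<^sub>R (c *\<^sub>R p - b *\<^sub>R q) - b *\<^sub>R ((b / (b + c)) *\<^sub>R (p + q) - q) = (c - b) *\<^sub>R p"
proof -
  define k l where "k = b / (b + c)" and "l = c / (b + c)"
  have kl: "k * (b + c) = b" "l * (b + c) = c" using s by (simp_all add: k_def l_def)
  have "(b + c) * (l * c - b * k) = (l * (b + c)) * c - b * (k * (b + c))" by (simp add: algebra_simps)
  also have "\<dots> = (b + c) * (c - b)" unfolding kl by (simp add: algebra_simps)
  finally have 1: "l * c - b * k = c - b" using s by simp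
  have "(b + c) * (b - l * b - b * k) = b * (b + c) - (l * (b + c)) * b - b * (k * (b + c))" by (simp add: algebra_simps)
  also have "\<dots> = (b + c) * 0" unfolding kl by (simp add: algebra_simps)
  finally have 2: "b - l * b - b * k = 0" using s by simp
  have "l *\<^sub>R (c *\<^sub>R p - b *\<^sub>R q) - b *\<^sub>R (k *\<^sub>R (p + q) - q) =
      (l * c - b * k) *\<^sub>R p + (b - l * b - b * k) *\<^sub>R q"
    by (simp add: algebra_simps)
  then show ?thesis unfolding 1 2 by (simp add: k_def l_def)
qed

section \<open>Assembling the cover and comparing areas\<close>

lemma triquadratic_cover:
  fixes a b c :: nat and p q A :: point
  assumes pos: "0 < a" "0 < b" and eq: "a\<^sup>2 + b * c = c\<^sup>2"
    and p: "norm p = c" and q: "norm q = c" and pq: "norm (real c *\<^sub>R p - real b *\<^sub>R q) = a * (b + c)"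
  shows "tile_cover a b c (c\<^sup>2 + b * c) (convex hull {A, A + real c *\<^sub>R p, A + real b *\<^sub>R q})"
proof -
  have bc: "b < c"
  proof (rule ccontr)
    assume "\<not> b < c"
    then have "c * c \<le> b * c" by simp
    moreover have "0 < a\<^sup>2" using pos by simp
    ultimately show False using eq unfolding power2_eq_square by linarith
  qed
  have eqr: "(real a)\<^sup>2 + real b * real c = (real c)\<^sup>2"
    using eq by (metis of_nat_add of_nat_mult of_nat_power)
  define r where "r = (real b / (real b + real c)) *\<^sub>R (p + q)"
  have n: "norm r = b" "norm (p - r) = a" "norm (q - r) = a"
    unfolding r_def using triquadratic_norms[of a b c p q] pos bc eqr p q pq by simp_all
  define B where "B = A + real c *\<^sub>R p"
  define C where "C = A + real b *\<^sub>R q"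
  \<comment> \<open>\<open>e\<close> and \<open>f\<close> are the sides CY and CO of the piece COY,
    shrunk by its scale factor \<open>a\<close> to tile edges.\<close>
  define e where "e = (1 / real a) *\<^sub>R (real c / (real b + real c)) *\<^sub>R (real c *\<^sub>R p - real b *\<^sub>R q)"
  define f where "f = (1 / real a) *\<^sub>R real b *\<^sub>R (r - q)"
  have ne: "norm e = c"
    using pos by (simp add: e_def pq)
  have nf: "norm f = b"
    using pos n by (simp add: f_def norm_minus_commute)
  have "(real c / (real b + real c)) *\<^sub>R (real c *\<^sub>R p - real b *\<^sub>R q) - real b *\<^sub>R (r - q) = (real c - real b) *\<^sub>R p"
    unfolding r_def using bc by (intro triquadratic_short_edge) simp
  then have "e - f = (1 / real a) *\<^sub>R (real c - real b) *\<^sub>R p"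
    unfolding e_def f_def by (simp only: scaleR_diff_right[symmetric])
  then have "norm (e - f) = (real c - real b) * c / a" using bc p by simp
  also have "(real c - real b) * c = a * a" using eqr by (simp add: power2_eq_square algebra_simps)
  finally have nef: "norm (e - f) = a" using pos by simp
  have P1: "tile_cover a b c (b\<^sup>2) (convex hull {A, A + real b *\<^sub>R p, A + real b *\<^sub>R r})"
    and P2: "tile_cover a b c (b\<^sup>2) (convex hull {A, A + real b *\<^sub>R q, A + real b *\<^sub>R r})"
    and P3: "tile_cover a b c (a\<^sup>2) (convex hull {C, C + real a *\<^sub>R e, C + real a *\<^sub>R f})"
    using pos p q n ne nf nef by (simp_all add: tile_cover_triangle)
  have P4: "tile_cover a b c (2 * (c - b) * b)
      {B + x *\<^sub>R (- p) + y *\<^sub>R (r - p) | x y. 0 \<le> x \<and> x \<le> real (c - b) \<and> 0 \<le> y \<and> y \<le> real b}"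
    using pos bc p n
    by (intro tile_cover_swap[OF tile_cover_parallelogram]) (simp_all add: norm_minus_commute)
  have "a\<^sup>2 + 2 * (c - b) * b + 2 * b\<^sup>2 = c\<^sup>2 + b * c"
  proof -
    \<comment> \<open>Removes the truncated subtraction c - b.\<close>
    obtain d where "c = b + d" using bc less_imp_add_positive by blast
    then show ?thesis using eq by (simp add: power2_eq_square algebra_simps)
  qed
  then have "b\<^sup>2 + b\<^sup>2 + a\<^sup>2 + 2 * (c - b) * b = c\<^sup>2 + b * c" by simp
  moreover have "real a *\<^sub>R e = (real c / (real b + real c)) *\<^sub>R (real c *\<^sub>R p - real b *\<^sub>R q)"
    "real a *\<^sub>R f = real b *\<^sub>R (r - q)" using pos by (simp_all add: e_def f_def)
  ultimately show ?thesis
    using tile_cover_Un[OF tile_cover_Un[OF tile_cover_Un[OF P1 P2] P3] P4]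
      triquadratic_dissection[of b c A p q] pos bc
    by (simp add: r_def[symmetric] B_def[symmetric] C_def[symmetric] of_nat_diff)
qed

text \<open>The area count compares determinants: ABC has edges c p and b q, while a tile has edges
  \<open>p\<close> and \<open>r\<close>, whose determinant is b / (b + c) times that of
  \<open>p\<close> and \<open>q\<close>. The ratio of areas is c (b + c).\<close>

lemma triquadratic_tiling:
  fixes a b c :: nat
  assumes pos: "0 < a" "0 < b" "0 < c" and eq: "a\<^sup>2 + b * c = c\<^sup>2"
    and ABC: "triangle_with_sides A B C (real a * (real b + real c)) (real b * real c) ((real c)\<^sup>2)"
    and PQR: "triangle_with_sides P Q R a b c"
  shows "\<exists>\<T>. is_tiling (c\<^sup>2 + b * c) (convex hull {A, B, C}) (convex hull {P, Q, R}) \<T>"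
proof (rule tiling_of_cover[OF _ PQR])
  have d: "dist B C = real a * (real b + real c)" "dist A C = real b * real c" "dist A B = (real c)\<^sup>2"
    using ABC by (auto simp: triangle_with_sides_def)
  define p where "p = (1 / real c) *\<^sub>R (B - A)"
  define q where "q = (1 / real b) *\<^sub>R (C - A)"
  have B: "B = A + real c *\<^sub>R p" and C: "C = A + real b *\<^sub>R q" using pos by (simp_all add: p_def q_def)
  have n: "norm p = c" "norm q = c"
    using d pos by (simp_all add: p_def q_def dist_norm norm_minus_commute power2_eq_square)
  have "real c *\<^sub>R p - real b *\<^sub>R q = B - C" by (simp add: B C)
  then have pq: "norm (real c *\<^sub>R p - real b *\<^sub>R q) = a * (b + c)" using d by (simp add: dist_norm)
  show "tile_cover a b c (c\<^sup>2 + b * c) (convex hull {A, B, C})"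
    unfolding B C by (rule triquadratic_cover[OF pos(1,2) eq n pq])
  have eqr: "(real a)\<^sup>2 + real b * real c = (real c)\<^sup>2"
    using eq by (metis of_nat_add of_nat_mult of_nat_power)
  define r where "r = (real b / (real b + real c)) *\<^sub>R (p + q)"
  have nr: "norm r = b" "norm (p - r) = a"
    unfolding r_def using triquadratic_norms[of a b c p q] pos eqr n pq by simp_all
  have "is_tile a b c (convex hull {P, Q, R})"
    using PQR unfolding is_tile_def triangle_with_sides_def by blast
  then have "measure lebesgue (convex hull {P, Q, R}) = measure lebesgue (convex hull {0, 0 + p, 0 + r})"
    by (rule measure_is_tile_cong) (rule is_tile_hull[OF n(1) nr])
  also have "\<dots> = \<bar>cross2 p r\<bar> / 2" by (rule measure_hull_cross2)
  also have "cross2 p r = real b / (real b + real c) * cross2 p q"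
    by (simp add: r_def cross2_def algebra_simps)
  finally have T: "measure lebesgue (convex hull {P, Q, R}) = real b / (real b + real c) * \<bar>cross2 p q\<bar> / 2"
    by (simp add: abs_mult)
  have "measure lebesgue (convex hull {A, B, C}) = real b * real c * \<bar>cross2 p q\<bar> / 2"
    unfolding B C measure_hull_cross2 cross2_scaleR by (simp add: abs_mult)
  then show "measure lebesgue (convex hull {A, B, C}) =
      real (c\<^sup>2 + b * c) * measure lebesgue (convex hull {P, Q, R})"
    unfolding T using pos by (simp add: field_simps power2_eq_square)
qed

section \<open>Existence and angles\<close>

text \<open>The last hypothesis says that the cosine prescribed at A lies strictly between -1 and 1.
  With A at the origin and B on the first axis, C has abscissa \<open>h\<close> by the law of
  cosines and height \<open>k\<close>.\<close>

lemma triangle_with_sides_exists: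
  fixes x y z :: real
  assumes pos: "0 < x" "0 < y" "0 < z" and lt: "\<bar>y\<^sup>2 + z\<^sup>2 - x\<^sup>2\<bar> < 2 * y * z"
  shows "\<exists>A B C. triangle_with_sides A B C x y z"
proof -
  define h k where "h = (y\<^sup>2 + z\<^sup>2 - x\<^sup>2) / (2 * z)" and "k = sqrt (y\<^sup>2 - h\<^sup>2)"
  have hz: "2 * z * h = y\<^sup>2 + z\<^sup>2 - x\<^sup>2" using pos by (simp add: h_def)
  have "\<bar>h\<bar> < y" using lt pos by (simp add: h_def field_simps)
  then have "h\<^sup>2 < y\<^sup>2" by (metis abs_ge_zero power2_abs power_strict_mono zero_less_numeral)
  then have k: "k > 0" "k\<^sup>2 = y\<^sup>2 - h\<^sup>2" by (simp_all add: k_def)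
  define B C :: point where "B = vector [z, 0]" and "C = vector [h, k]"
  have "cross2 B C \<noteq> 0" using k pos by (simp add: cross2_def B_def C_def)
  then have "\<not> collinear {0, B, C}" by (simp add: cross2_eq_0_iff)
  moreover have "dist 0 B = z" using pos by (simp add: norm_eq_sqrt_inner inner_vec_def sum_2 B_def)
  moreover have "dist 0 C = y"
    using pos k by (simp add: norm_eq_sqrt_inner inner_vec_def sum_2 C_def flip: power2_eq_square)
  moreover have "dist B C = x"
  proof -
    have "(z - h)\<^sup>2 + k\<^sup>2 = x\<^sup>2" using k(2) hz by (simp add: power2_diff)
    then show ?thesis
      using pos by (simp add: dist_norm norm_eq_sqrt_inner inner_vec_def sum_2 B_def C_def flip: power2_eq_square)
  qed
  ultimately show ?thesis unfolding triangle_with_sides_def by blast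
qed

lemma triangle_with_sides_perm:
  assumes "triangle_with_sides A B C x y z"
  shows "triangle_with_sides B A C y x z" "triangle_with_sides C A B z x y"
  using assms by (simp_all add: triangle_with_sides_def dist_commute insert_commute)

lemma angle_cosine_rule:
  assumes "triangle_with_sides A B C x y z"
  shows "angle B A C = arccos ((y\<^sup>2 + z\<^sup>2 - x\<^sup>2) / (2 * y * z))"
proof -
  have d: "norm (B - A) = z" "norm (C - A) = y" "norm ((B - A) - (C - A)) = x"
    using assms by (auto simp: triangle_with_sides_def dist_norm norm_minus_commute)
  have "(B - A) \<bullet> (C - A) = (y\<^sup>2 + z\<^sup>2 - x\<^sup>2) / 2"
    using dot_norm_neg[of "B - A" "C - A"] d by (simp add: add.commute)
  then show ?thesis unfolding angle_def d by (simp only: divide_divide_eq_left mult.assoc mult.commute mult.left_commute)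
qed

text \<open>The side relation expresses \<open>a\<close> and \<open>b\<close> through
  \<open>c\<close> and x = a / (2 c), so all cosines become polynomials in x = sin t. They match the
  multiple-angle formulas for 2 t, 4 t, pi/2 - 3 t and pi/2 - t.\<close>

lemma triquadratic_angles:
  fixes a b c :: real
  assumes pos: "0 < a" "0 < b" "0 < c" and eq: "a\<^sup>2 + b * c = c\<^sup>2"
    and ABC: "triangle_with_sides A B C (a * (b + c)) (b * c) (c\<^sup>2)"
    and PQR: "triangle_with_sides P Q R a b c"
  shows "3 * angle Q P R + 2 * angle P Q R = pi" "angle B A C = 2 * angle Q P R"
    "angle A B C = angle P Q R" "angle A C B = angle Q P R + angle P Q R"
proof -
  define x where "x = a / (2 * c)"
  \<comment> \<open>All angles are affine in \<open>t\<close>: \<open>\<alpha> = 2 t\<close> and \<open>\<beta> = \<pi> / 2 - 3 t\<close>.\<close>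
  define t where "t = arcsin x"
  have a: "a = 2 * x * c" using pos by (simp add: x_def)
  have "c * b = c * (c * (1 - 4 * x\<^sup>2))" using eq a by algebra
  then have b: "b = c * (1 - 4 * x\<^sup>2)" using pos by simp
  have x0: "0 < x" using pos by (simp add: x_def)
  \<comment> \<open>Positivity of \<open>b\<close> bounds \<open>x\<close> by 1/2 and hence
    \<open>t\<close> by pi/6. Then all the angles lie between 0 and pi, where \<open>arccos\<close>
    inverts \<open>cos\<close>.\<close>
  have "0 < 1 - 4 * x\<^sup>2" using pos b by (simp add: zero_less_mult_iff)
  then have "x\<^sup>2 < (1/2)\<^sup>2" by (simp add: power2_eq_square)
  then have x1: "x < 1/2" by (rule power2_less_imp_less) simp
  have st: "sin t = x" using x0 x1 by (simp add: t_def)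
  have "arcsin 0 < arcsin x" using x0 x1 by (intro arcsin_less_arcsin) auto
  then have t0: "0 < t" by (simp add: t_def)
  have "arcsin x < arcsin (1/2)" using x0 x1 by (intro arcsin_less_arcsin) auto
  moreover have "arcsin (1/2) = pi / 6"
    using arcsin_sin[of "pi / 6"] by (simp add: sin_30)
  ultimately have t1: "t < pi / 6" by (simp add: t_def)
  have c1: "cos (pi / 2 - t) = x" by (simp add: cos_diff st)
  have c2: "cos (2 * t) = 1 - 2 * x\<^sup>2" by (simp add: cos_double_sin st)
  have c4: "cos (4 * t) = 2 * (1 - 2 * x\<^sup>2)\<^sup>2 - 1"
    using cos_double_cos[of "2 * t"] c2 by simp
  have c3: "cos (pi / 2 - 3 * t) = 3 * x - 4 * x ^ 3"
  proof -
    have "cos (pi / 2 - 3 * t) = sin (2 * t + t)" by (simp add: cos_diff)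
    also have "\<dots> = 2 * sin t * (cos t)\<^sup>2 + (1 - 2 * x\<^sup>2) * sin t"
      by (simp only: sin_add c2) (simp add: sin_double power2_eq_square)
    also have "\<dots> = 3 * x - 4 * x ^ 3"
      by (simp only: cos_squared_eq st) algebra
    finally show ?thesis .
  qed
  \<comment> \<open>Reduces each cosine to a polynomial identity.\<close>
  have quot: "u / v = w" if "u = w * v" "v \<noteq> 0" for u v w :: real using that by simp
  have nz: "b + c \<noteq> 0" using pos by simp
  have al: "angle Q P R = 2 * t"
  proof -
    have "(b\<^sup>2 + c\<^sup>2 - a\<^sup>2) / (2 * b * c) = cos (2 * t)"
      unfolding c2 by (rule quot, use a b in algebra, use pos in simp)
    then show ?thesis using t0 t1 by (simp add: angle_cosine_rule[OF PQR] arccos_cos)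
  qed
  have be: "angle P Q R = pi / 2 - 3 * t"
  proof -
    have "(a\<^sup>2 + c\<^sup>2 - b\<^sup>2) / (2 * a * c) = cos (pi / 2 - 3 * t)"
      unfolding c3 by (rule quot, use a b in algebra, use pos in simp)
    then show ?thesis using t0 t1 by (simp add: angle_cosine_rule[OF triangle_with_sides_perm(1)[OF PQR]] arccos_cos)
  qed
  have A: "angle B A C = 4 * t"
  proof -
    have "((b * c)\<^sup>2 + (c\<^sup>2)\<^sup>2 - (a * (b + c))\<^sup>2) / (2 * (b * c) * c\<^sup>2) = cos (4 * t)"
      unfolding c4 by (rule quot, use a b in algebra, use pos in simp)
    then show ?thesis using t0 t1 by (simp add: angle_cosine_rule[OF ABC] arccos_cos)
  qed
  have B: "angle A B C = pi / 2 - 3 * t"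
  proof -
    have "((a * (b + c))\<^sup>2 + (c\<^sup>2)\<^sup>2 - (b * c)\<^sup>2) / (2 * (a * (b + c)) * c\<^sup>2) = cos (pi / 2 - 3 * t)"
      unfolding c3 by (rule quot, use a b in algebra, use pos nz in simp)
    then show ?thesis using t0 t1 by (simp add: angle_cosine_rule[OF triangle_with_sides_perm(1)[OF ABC]] arccos_cos)
  qed
  have C: "angle A C B = pi / 2 - t"
  proof -
    have "((a * (b + c))\<^sup>2 + (b * c)\<^sup>2 - (c\<^sup>2)\<^sup>2) / (2 * (a * (b + c)) * (b * c)) = cos (pi / 2 - t)"
      unfolding c1 by (rule quot, use a b in algebra, use pos nz in simp)
    then show ?thesis using t0 t1 by (simp add: angle_cosine_rule[OF triangle_with_sides_perm(2)[OF ABC]] arccos_cos)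
  qed
  show "3 * angle Q P R + 2 * angle P Q R = pi" "angle B A C = 2 * angle Q P R"
    "angle A B C = angle P Q R" "angle A C B = angle Q P R + angle P Q R"
    unfolding al be A B C by simp_all
qed

text \<open>Keeps the theorem's statement about all such triangles from being vacuous. The relation
  forces b < c, from which both cosine bounds follow.\<close>

lemma triquadratic_triangles_exist:
  fixes a b c :: real
  assumes pos: "0 < a" "0 < b" "0 < c" and eq: "a\<^sup>2 + b * c = c\<^sup>2"
  shows "\<exists>A B C. triangle_with_sides A B C (a * (b + c)) (b * c) (c\<^sup>2)"
    "\<exists>P Q R. triangle_with_sides P Q R a b c"
proof -
  have "0 < a\<^sup>2" using pos by simp
  with eq have "c * b < c * c" by (simp add: power2_eq_square mult.commute)
  then have bc: "b < c" using pos by simp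
  show "\<exists>P Q R. triangle_with_sides P Q R a b c"
  proof (rule triangle_with_sides_exists[OF pos])
    have "b\<^sup>2 + c\<^sup>2 - a\<^sup>2 = b * (b + c)" using eq by (simp add: power2_eq_square algebra_simps)
    moreover have "b * (b + c) < b * (2 * c)" using pos bc by simp
    ultimately show "\<bar>b\<^sup>2 + c\<^sup>2 - a\<^sup>2\<bar> < 2 * b * c" using pos by simp
  qed
  show "\<exists>A B C. triangle_with_sides A B C (a * (b + c)) (b * c) (c\<^sup>2)"
  proof (rule triangle_with_sides_exists)
    have e: "(b * c)\<^sup>2 + (c\<^sup>2)\<^sup>2 - (a * (b + c))\<^sup>2 = (b * c) * (2 * b * c - c\<^sup>2 + b\<^sup>2)"
      using eq by algebra
    have "b * c < c\<^sup>2" "0 < b * c" "b\<^sup>2 < c\<^sup>2" "0 < b\<^sup>2"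
      using pos bc by (simp_all add: power2_eq_square mult_strict_mono)
    then have "\<bar>2 * b * c - c\<^sup>2 + b\<^sup>2\<bar> < 2 * c\<^sup>2" by linarith
    then have "(b * c) * \<bar>2 * b * c - c\<^sup>2 + b\<^sup>2\<bar> < (b * c) * (2 * c\<^sup>2)" using pos by simp
    then show "\<bar>(b * c)\<^sup>2 + (c\<^sup>2)\<^sup>2 - (a * (b + c))\<^sup>2\<bar> < 2 * (b * c) * c\<^sup>2"
      unfolding e using pos by (simp add: abs_mult mult_ac)
  qed (use pos in auto)
qed

theorem theorem5:
  fixes M N K :: nat
  assumes "N > 0" and "M > 0" and "K > 0"
    and "M\<^sup>2 + N = 2 * K\<^sup>2" and "M\<^sup>2 < N"
  shows "(K dvd N \<longleftrightarrow> K dvd M\<^sup>2) \<and>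
    (K dvd N \<longrightarrow>
      (let BC = real M * real N / real K; AC = real N - (real K)\<^sup>2; AB = (real K)\<^sup>2;
           a = real M; b = real N / real K - real K; c = real K
       in
        b \<in> \<nat> \<and> b > 0 \<and>
        (\<exists>A B C. triangle_with_sides A B C BC AC AB) \<and>
        (\<exists>P Q R. triangle_with_sides P Q R a b c) \<and>
        (\<forall>A B C P Q R.
          triangle_with_sides A B C BC AC AB \<and> triangle_with_sides P Q R a b c \<longrightarrow>
          (\<exists>\<T>. is_tiling N (convex hull {A, B, C}) (convex hull {P, Q, R}) \<T>) \<and>
          (let \<alpha> = angle Q P R; \<beta> = angle P Q R
           in
            3 * \<alpha> + 2 * \<beta> = pi \<and>
            angle B A C = 2 * \<alpha> \<and> angle A B C = \<beta> \<and> angle A C B = \<alpha> + \<beta>))))"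
proof (intro conjI impI)
  have "K dvd M\<^sup>2 + N" using assms(4) by (simp add: power2_eq_square)
  then show "K dvd N \<longleftrightarrow> K dvd M\<^sup>2" by (metis dvd_add_left_iff dvd_add_right_iff)
next
  assume "K dvd N"
  then obtain j where j: "N = K * j" by blast
  \<comment> \<open>N is the larger summand of \<open>2 * K\<^sup>2\<close>, so it exceeds
    \<open>K\<^sup>2\<close>; this makes b = j - K positive.\<close>
  have "K * K < K * j" using assms(4,5) unfolding j power2_eq_square by linarith
  then have "K < j" by simp
  then obtain b where b: "j = K + b" "0 < b" using less_imp_add_positive by blast
  have eq: "M\<^sup>2 + b * K = K\<^sup>2" using assms(4) by (simp add: j b power2_eq_square algebra_simps)
  then have eqr: "(real M)\<^sup>2 + real b * real K = (real K)\<^sup>2"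
    by (metis of_nat_add of_nat_mult of_nat_power)
  have N: "N = K\<^sup>2 + b * K" by (simp add: j b power2_eq_square algebra_simps)
  have sides: "real M * real N / real K = real M * (real b + real K)"
    "real N - (real K)\<^sup>2 = real b * real K" "real N / real K - real K = real b"
    using assms(3) by (simp_all add: N field_simps power2_eq_square)
  have pos: "0 < real M" "0 < real b" "0 < real K" using assms b by simp_all
  show "let BC = real M * real N / real K; AC = real N - (real K)\<^sup>2; AB = (real K)\<^sup>2;
           a = real M; b = real N / real K - real K; c = real K
       in
        b \<in> \<nat> \<and> b > 0 \<and>
        (\<exists>A B C. triangle_with_sides A B C BC AC AB) \<and>
        (\<exists>P Q R. triangle_with_sides P Q R a b c) \<and>
        (\<forall>A B C P Q R.
          triangle_with_sides A B C BC AC AB \<and> triangle_with_sides P Q R a b c \<longrightarrow>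
          (\<exists>\<T>. is_tiling N (convex hull {A, B, C}) (convex hull {P, Q, R}) \<T>) \<and>
          (let \<alpha> = angle Q P R; \<beta> = angle P Q R
           in
            3 * \<alpha> + 2 * \<beta> = pi \<and>
            angle B A C = 2 * \<alpha> \<and> angle A B C = \<beta> \<and> angle A C B = \<alpha> + \<beta>))"
    unfolding Let_def sides
  proof (intro conjI allI impI; (elim conjE)?)
    show "\<exists>A B C. triangle_with_sides A B C (real M * (real b + real K)) (real b * real K) ((real K)\<^sup>2)"
      "\<exists>P Q R. triangle_with_sides P Q R (real M) (real b) (real K)"
      by (rule triquadratic_triangles_exist[OF pos eqr])+
  next
    fix A B C P Q R
    assume t: "triangle_with_sides A B C (real M * (real b + real K)) (real b * real K) ((real K)\<^sup>2)"
      "triangle_with_sides P Q R (real M) (real b) (real K)"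
    show "\<exists>\<T>. is_tiling N (convex hull {A, B, C}) (convex hull {P, Q, R}) \<T>"
      unfolding N using triquadratic_tiling[OF _ _ _ eq t] assms b by simp
    show "3 * angle Q P R + 2 * angle P Q R = pi" "angle B A C = 2 * angle Q P R"
      "angle A B C = angle P Q R" "angle A C B = angle Q P R + angle P Q R"
      by (rule triquadratic_angles[OF pos eqr t])+
  qed (use b in simp_all)
qed

end
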